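(* Let $H\colon T^{*}\mathbb{R}^{d}\cong\mathbb{R}^{2d}\to\mathbb{R}$ be a smooth Hamiltonian, and let $a=(a_{q},a_{p})\in\mathbb{R}^{2d}$ with $a_{q},a_{p}\in\mathbb{R}^{d}$. The function $L_{a}(z)=a^{T}z$ is a linear invariant of the Hamiltonian system $\dot q=D_{2}H(q,p)$, $\dot p=-D_{1}H(q,p)$ (with $z=(q,p)$) if and only if the function $$\hat L_{a}(\zeta)=\hat a^{T}\zeta,\qquad \zeta=(q,x,p,y)\in T^{*}\mathbb{R}^{2d}\cong\mathbb{R}^{4d},\qquad \hat a=\tfrac12(a_{q},a_{q},a_{p},a_{p})\in\mathbb{R}^{4d},$$ is a linear invariant of the extended Hamiltonian system $$\dot q=D_{2}H(x,p),\quad \dot p=-D_{1}H(q,y),\quad \dot x=D_{2}H(q,y),\quad \dot y=-D_{1}H(x,p).$$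
   Context: $D_{1}H$ and $D_{2}H$ denote the partial gradients of $H$ with respect to its first and second $\mathbb{R}^{d}$-valued arguments. Tuples denote column vectors. The extended system is the canonical Hamiltonian system on $\mathbb{R}^{4d}$ (positions $(q,x)$, momenta $(p,y)$) with Hamiltonian $\hat H(q,x,p,y)=H(q,y)+H(x,p)$. A function is an invariant of an ODE system if it is constant along all solutions of the system; for a smooth function and a Hamiltonian system this is equivalent to the identical vanishing of its Poisson bracket with the Hamiltonian, where $\{F,G\}=(DF)^{T}\mathbb{J}\,DG$ with $\mathbb{J}$ the standard symplectic matrix $\begin{bmatrix}0&I\\-I&0\end{bmatrix}$ of the appropriate size. *)

theory Defs
  imports "HOL-Analysis.Analysis"
begin

text \<open>
  On a Euclidean space a function is of class \<open>C\<^sup>k\<^sup>+\<^sup>1\<close> iff it is differentiable everywhere and all its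
  directional derivatives are of class \<open>C\<^sup>k\<close>.
\<close>

primrec Ck :: "nat \<Rightarrow> ('a::euclidean_space \<Rightarrow> 'b::real_normed_vector) \<Rightarrow> bool" where
  "Ck 0 f \<longleftrightarrow> continuous_on UNIV f"
| "Ck (Suc k) f \<longleftrightarrow>
     (\<forall>x. f differentiable (at x)) \<and> (\<forall>v. Ck k (\<lambda>x. frechet_derivative f (at x) v))"

definition smooth :: "('a::euclidean_space \<Rightarrow> 'b::real_normed_vector) \<Rightarrow> bool" where
  "smooth f \<longleftrightarrow> (\<forall>k. Ck k f)"

definition grad :: "('a::euclidean_space \<Rightarrow> real) \<Rightarrow> 'a \<Rightarrow> 'a" where
  "grad f x = (THE D. GDERIV f x :> D)"

definition D1 :: "('a::euclidean_space \<times> 'b::euclidean_space \<Rightarrow> real) \<Rightarrow> 'a \<times> 'b \<Rightarrow> 'a" where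
  "D1 H z = grad (\<lambda>u. H (u, snd z)) (fst z)"

definition D2 :: "('a::euclidean_space \<times> 'b::euclidean_space \<Rightarrow> real) \<Rightarrow> 'a \<times> 'b \<Rightarrow> 'b" where
  "D2 H z = grad (\<lambda>u. H (fst z, u)) (snd z)"

definition is_solution :: "('a::real_normed_vector \<Rightarrow> 'a) \<Rightarrow> real set \<Rightarrow> (real \<Rightarrow> 'a) \<Rightarrow> bool" where
  "is_solution X I z \<longleftrightarrow>
     is_interval I \<and> (\<forall>t\<in>I. (z has_vector_derivative X (z t)) (at t within I))"

definition invariant :: "('a::real_normed_vector \<Rightarrow> 'b) \<Rightarrow> ('a \<Rightarrow> 'a) \<Rightarrow> bool" where
  "invariant F X \<longleftrightarrow> (\<forall>I z. is_solution X I z \<longrightarrow> (\<forall>s\<in>I. \<forall>t\<in>I. F (z s) = F (z t)))"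

definition linear_invariant :: "('a::real_normed_vector \<Rightarrow> real) \<Rightarrow> ('a \<Rightarrow> 'a) \<Rightarrow> bool" where
  "linear_invariant F X \<longleftrightarrow> linear F \<and> invariant F X"

definition ham_field :: "('a::euclidean_space \<times> 'a \<Rightarrow> real) \<Rightarrow> 'a \<times> 'a \<Rightarrow> 'a \<times> 'a" where
  "ham_field H z = (D2 H z, - D1 H z)"

text \<open>The points of the extended phase space are written \<open>((q, x), (p, y))\<close>.\<close>

definition ext_ham ::
    "('a::euclidean_space \<times> 'a \<Rightarrow> real) \<Rightarrow> ('a \<times> 'a) \<times> ('a \<times> 'a) \<Rightarrow> real" where
  "ext_ham H = (\<lambda>((q, x), (p, y)). H (q, y) + H (x, p))"

definition ext_field ::
    "('a::euclidean_space \<times> 'a \<Rightarrow> real)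
       \<Rightarrow> ('a \<times> 'a) \<times> ('a \<times> 'a) \<Rightarrow> ('a \<times> 'a) \<times> ('a \<times> 'a)" where
  "ext_field H = (\<lambda>((q, x), (p, y)).
     ((D2 H (x, p), D2 H (q, y)), (- D1 H (q, y), - D1 H (x, p))))"

lemma grad_eqI:
  assumes "GDERIV f x :> D"
  shows "grad f x = D"
  unfolding grad_def
proof (rule the_equality)
  show "GDERIV f x :> D" by fact
next
  fix E assume "GDERIV f x :> E"
  with assms have "(\<lambda>h. inner h D) = (\<lambda>h. inner h E)"
    unfolding gderiv_def by (rule has_derivative_unique)
  then have "inner h E = inner h D" for h
    by metis
  then show "E = D"
    by (metis vector_eq_ldot)
qed

lemma GDERIV_grad:
  assumes "f differentiable (at x)"
  shows "GDERIV f x :> grad f x"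
proof -
  obtain f' where f': "(f has_derivative f') (at x)"
    using assms by (auto simp: differentiable_def)
  have "f' = (\<lambda>h. inner h (adjoint f' 1))"
    using adjoint_works[OF has_derivative_linear[OF f'], of _ 1] by auto
  with f' have "GDERIV f x :> adjoint f' 1"
    unfolding gderiv_def by simp
  then show ?thesis
    using grad_eqI by metis
qed

lemma smooth_differentiable: "smooth f \<Longrightarrow> f differentiable (at x)"
  unfolding smooth_def by (metis Ck.simps(2))

text \<open>The extended system is the canonical Hamiltonian system with Hamiltonian \<open>ext_ham H\<close>.\<close>

lemma ham_field_ext_ham:
  fixes H :: "'a::euclidean_space \<times> 'a \<Rightarrow> real"
  assumes "smooth H"
  shows "ham_field (ext_ham H) = ext_field H"
proof
  fix \<zeta> :: "('a \<times> 'a) \<times> ('a \<times> 'a)"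
  obtain q x p y where \<zeta>: "\<zeta> = ((q, x), (p, y))"
    by (metis surj_pair)
  have d1: "GDERIV (\<lambda>u. H (u, w)) v :> D1 H (v, w)" for v w
  proof -
    have "(\<lambda>u. H (u, w)) differentiable (at v)"
      using differentiable_chain_at[of "\<lambda>u. (u, w)" v H] smooth_differentiable[OF assms]
      by (auto simp: o_def intro!: differentiable_Pair)
    from GDERIV_grad[OF this] show ?thesis by (simp add: D1_def)
  qed
  have d2: "GDERIV (\<lambda>u. H (w, u)) v :> D2 H (w, v)" for v w
  proof -
    have "(\<lambda>u. H (w, u)) differentiable (at v)"
      using differentiable_chain_at[of "\<lambda>u. (w, u)" v H] smooth_differentiable[OF assms]
      by (auto simp: o_def intro!: differentiable_Pair)
    from GDERIV_grad[OF this] show ?thesis by (simp add: D2_def)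
  qed
  have split: "GDERIV (\<lambda>u. f (fst u) + g (snd u)) (a, b) :> (A, B)"
    if f: "GDERIV f a :> A" and g: "GDERIV g b :> B" for f g :: "'a \<Rightarrow> real" and a b A B
  proof -
    have f': "((\<lambda>u. f (fst u)) has_derivative (\<lambda>h. fst h \<bullet> A)) (at (a, b))"
      using has_derivative_compose[OF has_derivative_fst[OF has_derivative_ident[of "at (a, b)"]], of f "\<lambda>h. h \<bullet> A"] f
      by (simp add: gderiv_def)
    have g': "((\<lambda>u. g (snd u)) has_derivative (\<lambda>h. snd h \<bullet> B)) (at (a, b))"
      using has_derivative_compose[OF has_derivative_snd[OF has_derivative_ident[of "at (a, b)"]], of g "\<lambda>h. h \<bullet> B"] g
      by (simp add: gderiv_def)
    show ?thesis
      using has_derivative_add[OF f' g'] by (simp add: gderiv_def inner_prod_def)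
  qed
  have "D1 (ext_ham H) \<zeta> = (D1 H (q, y), D1 H (x, p))"
    using grad_eqI[OF split[OF d1[of y q] d1[of p x]]]
    unfolding D1_def[of "ext_ham H"] by (simp add: ext_ham_def \<zeta> case_prod_beta)
  moreover have "D2 (ext_ham H) \<zeta> = (D2 H (x, p), D2 H (q, y))"
    using grad_eqI[OF split[OF d2[of x p] d2[of q y]]]
    unfolding D2_def[of "ext_ham H"] by (simp add: ext_ham_def \<zeta> case_prod_beta add.commute)
  ultimately show "ham_field (ext_ham H) \<zeta> = ext_field H \<zeta>"
    by (simp add: ham_field_def ext_field_def \<zeta>)
qed

end

theory Submission
  imports Defs
begin

text \<open>
  A linear function of inner-product form with a vector \<open>a\<close> is an invariant of a locally Lipschitz
  field \<open>X\<close> iff \<open>a \<bullet> X\<close> vanishes identically: its derivative along a solution is \<open>a \<bullet> X\<close>, and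
  local existence (Picard) provides a solution through every point. Hence, if \<open>L\<^sub>a\<close> is an invariant,
  \<open>g(q, p) = a\<^sub>q \<bullet> D\<^sub>2H(q, p) - a\<^sub>p \<bullet> D\<^sub>1H(q, p)\<close> is zero everywhere, and the extended function has derivative
  \<open>(g(q, y) + g(x, p)) / 2\<close>. Conversely, a solution \<open>(q, p)\<close> doubles to a
  solution \<open>(q, q, p, p)\<close> of the extended system, along which the extended function equals \<open>L\<^sub>a\<close>.
\<close>

section \<open>Local existence of solutions for Lipschitz fields\<close>

text \<open>Banach's fixed point theorem, applied to the Picard integral operator on the complete
  space of bounded continuous functions on the real line. A short enough time step makes the
  operator a 1/2-contraction and keeps its fixed point inside the ball.\<close>

lemma picard_local_existence:
  fixes X :: "'a::euclidean_space \<Rightarrow> 'a"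
  assumes lip: "L-lipschitz_on (cball z0 r) X" and r: "r > 0"
  obtains h z where "h > 0" "z 0 = z0"
    "\<And>t. t \<in> {0..h} \<Longrightarrow> (z has_vector_derivative X (z t)) (at t within {0..h})"
proof -
  \<comment> \<open>Precomposing with the projection onto the ball makes the field globally Lipschitz and bounded.\<close>
  define Y where "Y x = X (closest_point (cball z0 r) x)" for x
  define M where "M = norm (X z0) + L * r"
  have L: "L \<ge> 0" using lip by (rule lipschitz_on_nonneg)
  have M: "M \<ge> 0" using L r by (simp add: M_def)
  have ne: "cball z0 r \<noteq> {}" using r by simp
  have cp: "closest_point (cball z0 r) x \<in> cball z0 r" for x
    using closest_point_in_set[OF closed_cball ne] .
  have Ylip: "dist (Y x) (Y y) \<le> L * dist x y" for x y
  proof -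
    have "dist (Y x) (Y y) \<le> L * dist (closest_point (cball z0 r) x) (closest_point (cball z0 r) y)"
      unfolding Y_def using lipschitz_onD[OF lip cp cp] .
    also have "\<dots> \<le> L * dist x y"
      using closest_point_lipschitz[OF convex_cball closed_cball ne] L by (intro mult_left_mono) auto
    finally show ?thesis .
  qed
  have Ybd: "norm (Y x) \<le> M" for x
  proof -
    have "dist (Y x) (X z0) \<le> L * dist (closest_point (cball z0 r) x) z0"
      unfolding Y_def using r by (intro lipschitz_onD[OF lip cp]) auto
    also have "\<dots> \<le> L * r"
      using cp[of x] L by (intro mult_left_mono) (auto simp: dist_commute)
    finally show ?thesis
      unfolding M_def dist_norm using norm_triangle_sub[of "Y x" "X z0"] by linarith
  qed
  have Ycont: "continuous_on S Y" for S
    using Ylip L by (intro lipschitz_on_continuous_on[of L] lipschitz_onI) auto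
  \<comment> \<open>The first bound gives \<open>h * L \<le> 1/2\<close>, for the contraction; the
    second gives \<open>h * M \<le> r\<close>, for staying in the ball. Adding 1 keeps the
    denominators positive when \<open>L\<close> or \<open>M\<close> is 0.\<close>
  define h where "h = min (1 / (2 * (L + 1))) (r / (M + 1))"
  have h: "h > 0" using L M r by (simp add: h_def)
  have hL: "h * L \<le> 1/2"
  proof -
    have "h * L \<le> 1 / (2 * (L + 1)) * (L + 1)"
      using L h by (intro mult_mono) (auto simp: h_def)
    also have "\<dots> = 1/2" using L by (simp add: field_simps)
    finally show ?thesis .
  qed
  have hM: "h * M \<le> r"
  proof -
    have "h * M \<le> r / (M + 1) * (M + 1)"
      using M h r by (intro mult_mono) (auto simp: h_def)
    then show ?thesis using M by simp
  qed
  \<comment> \<open>Clamping time to \<open>{0..h}\<close> makes the integral below a bounded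
    continuous function of all real \<open>t\<close>, so that the operator acts on the type of
    bounded continuous functions.\<close>
  define c where "c t = max 0 (min h t)" for t :: real
  have c: "c t \<in> {0..h}" for t using h by (auto simp: c_def)
  have Yz: "continuous_on S (\<lambda>s. Y (apply_bcontfun z s))" for z and S :: "real set"
    by (intro continuous_on_compose2[OF Ycont[of UNIV]] continuous_intros) auto
  define P where "P z t = z0 + integral {0..c t} (\<lambda>s. Y (apply_bcontfun z s))"
    for z :: "real \<Rightarrow>\<^sub>C 'a" and t
  have P_bcontfun: "P z \<in> bcontfun" for z
  proof (rule bcontfun_normI)
    have "continuous_on {0..h} (\<lambda>u. integral {0..u} (\<lambda>s. Y (apply_bcontfun z s)))"
      by (intro indefinite_integral_continuous_1 integrable_continuous_real Yz)
    moreover have "continuous_on UNIV c"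
      unfolding c_def by (intro continuous_intros)
    ultimately have "continuous_on UNIV (\<lambda>t. integral {0..c t} (\<lambda>s. Y (apply_bcontfun z s)))"
      by (rule continuous_on_compose2) (use c in auto)
    then show "continuous_on UNIV (P z)"
      unfolding P_def by (intro continuous_intros)
    show "norm (P z t) \<le> norm z0 + M * h" for t
    proof -
      have "norm (integral {0..c t} (\<lambda>s. Y (apply_bcontfun z s))) \<le> M * (c t - 0)"
        using c[of t] Ybd by (intro integral_bound Yz) auto
      also have "\<dots> \<le> M * h" using c[of t] M by (intro mult_left_mono) auto
      finally show ?thesis
        unfolding P_def by (rule norm_triangle_le[OF add_left_mono])
    qed
  qed
  define T where "T z = Bcontfun (P z)" for z
  have T: "apply_bcontfun (T z) = P z" for z
    unfolding T_def using P_bcontfun by (rule Bcontfun_inverse)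
  have contr: "dist (T z) (T w) \<le> (1/2) * dist z w" for z w
  proof (rule dist_bound)
    fix t
    have "dist (T z t) (T w t) = norm (integral {0..c t} (\<lambda>s. Y (apply_bcontfun z s))
        - integral {0..c t} (\<lambda>s. Y (apply_bcontfun w s)))"
      by (simp add: T P_def dist_norm)
    also have "\<dots> = norm (integral {0..c t} (\<lambda>s. Y (apply_bcontfun z s) - Y (apply_bcontfun w s)))"
      by (simp add: integral_diff integrable_continuous_real Yz)
    also have "\<dots> \<le> (L * dist z w) * (c t - 0)"
    proof (rule integral_bound)
      fix s
      have "norm (Y (apply_bcontfun z s) - Y (apply_bcontfun w s)) \<le> L * dist (apply_bcontfun z s) (apply_bcontfun w s)"
        using Ylip[of "apply_bcontfun z s" "apply_bcontfun w s"] by (simp only: dist_norm)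
      also have "\<dots> \<le> L * dist z w"
        using L by (intro mult_left_mono dist_bounded)
      finally show "norm (Y (apply_bcontfun z s) - Y (apply_bcontfun w s)) \<le> L * dist z w" .
    qed (use c[of t] in \<open>auto intro!: continuous_intros Yz\<close>)
    also have "\<dots> \<le> (L * dist z w) * h"
      using c[of t] L by (intro mult_left_mono) auto
    also have "\<dots> \<le> (1/2) * dist z w"
      using mult_right_mono[OF hL, of "dist z w"] by (simp add: mult_ac)
    finally show "dist (T z t) (T w t) \<le> (1/2) * dist z w" .
  qed
  have "\<exists>!z. T z = z"
    by (rule banach_fix_type[of "1/2"]) (use contr in auto)
  then obtain z where fix_z: "T z = z" by auto
  have z: "apply_bcontfun z t = z0 + integral {0..t} (\<lambda>s. Y (apply_bcontfun z s))" if "t \<in> {0..h}" for t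
  proof -
    have "c t = t" using that by (auto simp: c_def)
    moreover have "apply_bcontfun z t = P z t" using T[of z] fix_z by simp
    ultimately show ?thesis by (simp add: P_def)
  qed
  \<comment> \<open>On \<open>{0..h}\<close> the fixed point moves at most
    \<open>M * h \<le> r\<close> away from \<open>z0\<close>. It stays in the ball, where the
    projection is the identity, and so it solves the original equation.\<close>
  have YX: "Y (apply_bcontfun z t) = X (apply_bcontfun z t)" if t: "t \<in> {0..h}" for t
  proof -
    have "norm (integral {0..t} (\<lambda>s. Y (apply_bcontfun z s))) \<le> M * (t - 0)"
      using t Ybd by (intro integral_bound Yz) auto
    also have "\<dots> \<le> M * h" using t M by (intro mult_left_mono) auto
    also have "\<dots> \<le> r" using hM by (simp add: mult.commute)
    finally have "apply_bcontfun z t \<in> cball z0 r"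
      using z[OF t] by (simp add: dist_norm)
    then show ?thesis by (simp add: Y_def closest_point_self)
  qed
  show ?thesis
  proof (rule that[OF h])
    show "apply_bcontfun z 0 = z0" using z[of 0] h by simp
    fix t assume t: "t \<in> {0..h}"
    have "((\<lambda>u. z0 + integral {0..u} (\<lambda>s. Y (apply_bcontfun z s))) has_vector_derivative
        0 + Y (apply_bcontfun z t)) (at t within {0..h})"
      by (intro has_vector_derivative_add has_vector_derivative_const
          integral_has_vector_derivative Yz t)
    then show "(apply_bcontfun z has_vector_derivative X (apply_bcontfun z t)) (at t within {0..h})"
      unfolding YX[OF t, symmetric] using has_vector_derivative_transform[OF t, of z] z by simp
  qed
qed

section \<open>Local Lipschitz bounds for the Hamiltonian field\<close>

text \<open>The derivative is bounded in operator norm on the compact ball, and the mean value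
  inequality applies because the ball is convex.\<close>

lemma Ck1_lipschitz_on_cball:
  fixes f :: "'a::euclidean_space \<Rightarrow> real"
  assumes "Ck 1 f"
  obtains L where "L-lipschitz_on (cball x0 r) f"
proof -
  have diff: "(f has_derivative frechet_derivative f (at x)) (at x)" for x
    using assms by (simp add: frechet_derivative_works[symmetric])
  \<comment> \<open>\<open>Ck\<close> gives continuity of the derivative in each fixed direction.
    The sum over the basis directions is therefore continuous, and it dominates the operator
    norm.\<close>
  define B where "B x = (\<Sum>b\<in>Basis. norm (frechet_derivative f (at x) b))" for x
  have "continuous_on (cball x0 r) B"
    unfolding B_def using assms
    by (auto intro!: continuous_intros intro: continuous_on_subset)
  then have "bounded (B ` cball x0 r)"
    by (intro compact_imp_bounded compact_continuous_image) auto
  then obtain C where C: "C > 0" "\<And>x. x \<in> cball x0 r \<Longrightarrow> B x \<le> C"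
    unfolding bounded_pos by (metis abs_le_D1 imageI real_norm_def)
  have "onorm (frechet_derivative f (at x)) \<le> C" if x: "x \<in> cball x0 r" for x
  proof (rule onorm_bound)
    fix v :: 'a
    have lin: "linear (frechet_derivative f (at x))"
      using diff[of x] by (rule has_derivative_linear)
    have "frechet_derivative f (at x) v = frechet_derivative f (at x) (\<Sum>b\<in>Basis. (v \<bullet> b) *\<^sub>R b)"
      by (simp add: euclidean_representation)
    also have "\<dots> = (\<Sum>b\<in>Basis. (v \<bullet> b) * frechet_derivative f (at x) b)"
      by (simp add: linear_sum[OF lin] linear_scale[OF lin])
    also have "norm \<dots> \<le> (\<Sum>b\<in>Basis. norm v * norm (frechet_derivative f (at x) b))"
      by (rule sum_norm_le) (simp add: abs_mult Basis_le_norm mult_right_mono)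
    also have "\<dots> = B x * norm v"
      by (simp add: B_def sum_distrib_left mult.commute)
    also have "\<dots> \<le> C * norm v"
      using C(2)[OF x] by (rule mult_right_mono) simp
    finally show "norm (frechet_derivative f (at x) v) \<le> C * norm v" .
  qed (use C in auto)
  then have "norm (f x - f y) \<le> C * norm (x - y)" if "x \<in> cball x0 r" "y \<in> cball x0 r" for x y
    using that by (intro differentiable_bound[of "cball x0 r" f "\<lambda>x. frechet_derivative f (at x)"])
      (auto intro: has_derivative_at_withinI diff)
  then have "C-lipschitz_on (cball x0 r) f"
    using C(1) by (intro lipschitz_onI) (auto simp: dist_norm)
  then show ?thesis by (rule that)
qed

lemma lipschitz_on_componentwise:
  fixes f :: "'a::metric_space \<Rightarrow> 'b::euclidean_space"
  assumes "\<And>b. b \<in> Basis \<Longrightarrow> (L b)-lipschitz_on S (\<lambda>x. f x \<bullet> b)"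
  shows "(\<Sum>b\<in>Basis. L b)-lipschitz_on S f"
proof (rule lipschitz_onI)
  fix x y assume xy: "x \<in> S" "y \<in> S"
  have "dist (f x) (f y) \<le> (\<Sum>b\<in>Basis. \<bar>(f x - f y) \<bullet> b\<bar>)"
    unfolding dist_norm by (rule norm_le_l1)
  also have "\<dots> \<le> (\<Sum>b\<in>Basis. L b * dist x y)"
    using lipschitz_onD[OF assms xy]
    by (intro sum_mono) (simp add: dist_real_def inner_diff_left)
  finally show "dist (f x) (f y) \<le> (\<Sum>b\<in>Basis. L b) * dist x y"
    by (simp add: sum_distrib_right)
qed (auto intro!: sum_nonneg lipschitz_on_nonneg[OF assms])

text \<open>Each component of the Hamiltonian field becomes a derivative of \<open>H\<close> in a
  fixed direction, the form in which \<open>Ck\<close> expresses regularity. The direction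
  \<open>(- v, u)\<close> is the transposed symplectic matrix applied to
  \<open>(u, v)\<close>.\<close>

lemma inner_ham_field:
  fixes H :: "'a::euclidean_space \<times> 'a \<Rightarrow> real"
  assumes "H differentiable (at z)"
  shows "ham_field H z \<bullet> (u, v) = frechet_derivative H (at z) (- v, u)"
proof -
  obtain q p where z: "z = (q, p)" by fastforce
  let ?D = "frechet_derivative H (at (q, p))"
  have D: "(H has_derivative ?D) (at (q, p))"
    using assms by (simp add: z frechet_derivative_works)
  have lin: "linear ?D" using D by (rule has_derivative_linear)
  have d1: "((\<lambda>w. H (w, p)) has_derivative (\<lambda>k. ?D (k, 0))) (at q)"
    by (rule has_derivative_compose[of "\<lambda>w. (w, p)" "\<lambda>k. (k, 0)", OF _ D])
      (auto intro!: derivative_eq_intros)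
  have d2: "((\<lambda>w. H (q, w)) has_derivative (\<lambda>k. ?D (0, k))) (at p)"
    by (rule has_derivative_compose[of "\<lambda>w. (q, w)" "\<lambda>k. (0, k)", OF _ D])
      (auto intro!: derivative_eq_intros)
  have "(\<lambda>k. k \<bullet> D1 H z) = (\<lambda>k. ?D (k, 0))"
    using GDERIV_grad[OF differentiableI[OF d1]] d1
    unfolding gderiv_def D1_def z fst_conv snd_conv by (rule has_derivative_unique)
  moreover have "(\<lambda>k. k \<bullet> D2 H z) = (\<lambda>k. ?D (0, k))"
    using GDERIV_grad[OF differentiableI[OF d2]] d2
    unfolding gderiv_def D2_def z fst_conv snd_conv by (rule has_derivative_unique)
  ultimately have "v \<bullet> D1 H z = ?D (v, 0)" "u \<bullet> D2 H z = ?D (0, u)"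
    by metis+
  moreover have "?D (- v, u) = ?D (0, u) - ?D (v, 0)"
    using linear_diff[OF lin, of "(0, u)" "(v, 0)"] by simp
  ultimately show ?thesis
    by (simp add: ham_field_def z inner_commute)
qed

text \<open>Two orders of differentiability of \<open>H\<close> are spent: one to form the
  components of the field as directional derivatives, one to make these components Lipschitz on the
  ball.\<close>

lemma smooth_ham_field_lipschitz_on_cball:
  fixes H :: "'a::euclidean_space \<times> 'a \<Rightarrow> real"
  assumes "smooth H"
  obtains L where "L-lipschitz_on (cball z0 r) (ham_field H)"
proof -
  have "\<exists>L. L-lipschitz_on (cball z0 r) (\<lambda>z. ham_field H z \<bullet> b)" for b
  proof -
    have "Ck (Suc 1) H" using assms unfolding smooth_def by blast
    then have "Ck 1 (\<lambda>z. frechet_derivative H (at z) (- snd b, fst b))"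
      unfolding Ck.simps(2)[of 1] by blast
    moreover have "(\<lambda>z. frechet_derivative H (at z) (- snd b, fst b)) = (\<lambda>z. ham_field H z \<bullet> b)"
      using inner_ham_field[OF smooth_differentiable[OF assms], of _ "fst b" "snd b"] by simp
    ultimately show ?thesis
      using Ck1_lipschitz_on_cball[of "\<lambda>z. ham_field H z \<bullet> b" z0 r] by metis
  qed
  then obtain L where "\<And>b. (L b)-lipschitz_on (cball z0 r) (\<lambda>z. ham_field H z \<bullet> b)"
    by metis
  then show ?thesis
    using that lipschitz_on_componentwise by metis
qed

section \<open>Linear invariants and orthogonality to the field\<close>

lemma has_vector_derivative_inner_const:
  fixes z :: "real \<Rightarrow> 'a::real_inner"
  assumes "(z has_vector_derivative D) (at t within I)"
  shows "((\<lambda>t. a \<bullet> z t) has_vector_derivative a \<bullet> D) (at t within I)"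
  using bounded_linear.has_vector_derivative[OF bounded_linear_inner_right assms] .

text \<open>Invariance speaks only about solutions, so local existence supplies one starting at
  \<open>z0\<close>. Along it \<open>a \<bullet> z t\<close> is constant, while its derivative at
  the start is \<open>a \<bullet> X z0\<close>.\<close>

lemma invariant_inner_imp_orthogonal:
  fixes X :: "'a::euclidean_space \<Rightarrow> 'a"
  assumes inv: "invariant (\<lambda>z. a \<bullet> z) X"
    and lip: "L-lipschitz_on (cball z0 r) X" "r > 0"
  shows "a \<bullet> X z0 = 0"
proof -
  obtain h z where h: "h > 0" and z0: "z 0 = z0"
    and z: "\<And>t. t \<in> {0..h} \<Longrightarrow> (z has_vector_derivative X (z t)) (at t within {0..h})"
    using picard_local_existence[OF lip] by metis
  have "is_solution X {0..h} z"
    using z by (auto simp: is_solution_def is_interval_cc)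
  then have const: "a \<bullet> z t = a \<bullet> z0" if "t \<in> {0..h}" for t
    using inv that h z0 unfolding invariant_def by (metis atLeastAtMost_iff less_imp_le order_refl)
  have 0: "(0::real) \<in> {0..h}" using h by simp
  have "((\<lambda>t. a \<bullet> z t) has_vector_derivative a \<bullet> X z0) (at 0 within {0..h})"
    using has_vector_derivative_inner_const[OF z[OF 0]] z0 by simp
  moreover have "((\<lambda>t. a \<bullet> z t) has_vector_derivative 0) (at 0 within {0..h})"
    by (rule has_vector_derivative_transform[OF 0 _ has_vector_derivative_const]) (rule const)
  \<comment> \<open>Since \<open>h > 0\<close>, the one-sided derivative at the endpoint 0 is
    unique, so the two values agree.\<close>
  ultimately show ?thesis
    using vector_derivative_unique_within_closed_interval[of 0 h 0] h 0 by auto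
qed

text \<open>Along any solution the derivative of \<open>a \<bullet> z t\<close> is
  \<open>a \<bullet> X (z t) = 0\<close>, and a function with zero derivative on an interval is
  constant.\<close>

lemma orthogonal_imp_invariant_inner:
  fixes X :: "'a::real_inner \<Rightarrow> 'a"
  assumes "\<And>z. a \<bullet> X z = 0"
  shows "invariant (\<lambda>z. a \<bullet> z) X"
  unfolding invariant_def
proof (intro allI impI ballI)
  fix I z s t assume sol: "is_solution X I z" and st: "s \<in> I" "t \<in> I"
  have "((\<lambda>t. a \<bullet> z t) has_derivative (\<lambda>h. 0)) (at u within I)" if "u \<in> I" for u
    using has_vector_derivative_inner_const[of z "X (z u)" u I a] sol that assms
    by (simp add: is_solution_def has_vector_derivative_def)
  moreover have "convex I" using sol by (simp add: is_solution_def is_interval_convex)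
  ultimately obtain c where "\<And>u. u \<in> I \<Longrightarrow> a \<bullet> z u = c"
    using has_derivative_zero_constant[of I "\<lambda>t. a \<bullet> z t"] by blast
  then show "a \<bullet> z s = a \<bullet> z t" using st by simp
qed

section \<open>Doubled solutions and the equivalence\<close>

text \<open>On the diagonal \<open>x = q\<close>, \<open>y = p\<close> the mixed arguments
  \<open>(x, p)\<close> and \<open>(q, y)\<close> coincide, so both halves of the extended system
  reduce to the original one.\<close>

lemma is_solution_ext_field_double:
  assumes "is_solution (ham_field H) I z"
  shows "is_solution (ext_field H) I (\<lambda>t. ((fst (z t), fst (z t)), (snd (z t), snd (z t))))"
proof -
  have "((\<lambda>t. ((fst (z t), fst (z t)), (snd (z t), snd (z t)))) has_vector_derivative
      ((D2 H (z t), D2 H (z t)), (- D1 H (z t), - D1 H (z t)))) (at t within I)"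
    if "t \<in> I" for t
  proof -
    have z: "(z has_vector_derivative ham_field H (z t)) (at t within I)"
      using assms that by (simp add: is_solution_def)
    show ?thesis
      using bounded_linear.has_vector_derivative[OF bounded_linear_fst z]
        bounded_linear.has_vector_derivative[OF bounded_linear_snd z]
      by (auto simp: ham_field_def intro!: has_vector_derivative_Pair)
  qed
  then show ?thesis
    using assms by (simp add: is_solution_def ext_field_def)
qed

theorem proposition6:
  fixes H :: "(real ^ 'd) \<times> (real ^ 'd) \<Rightarrow> real"
    and aq ap :: "real ^ 'd"
  assumes "smooth H"
  shows "linear_invariant (\<lambda>z. (aq, ap) \<bullet> z) (ham_field H) \<longleftrightarrow>
         linear_invariant (\<lambda>\<zeta>. ((1 / 2) *\<^sub>R ((aq, aq), (ap, ap))) \<bullet> \<zeta>) (ext_field H)"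
proof -
  let ?a = "(1 / 2) *\<^sub>R ((aq, aq), (ap, ap))"
  have "invariant (\<lambda>z. (aq, ap) \<bullet> z) (ham_field H) \<longleftrightarrow> invariant (\<lambda>\<zeta>. ?a \<bullet> \<zeta>) (ext_field H)"
  proof
    assume inv: "invariant (\<lambda>z. (aq, ap) \<bullet> z) (ham_field H)"
    have "(aq, ap) \<bullet> ham_field H z = 0" for z
      using smooth_ham_field_lipschitz_on_cball[OF assms, of z 1]
        invariant_inner_imp_orthogonal[OF inv] by (metis zero_less_one)
    then have g: "aq \<bullet> D2 H z = ap \<bullet> D1 H z" for z
      by (simp add: ham_field_def)
    show "invariant (\<lambda>\<zeta>. ?a \<bullet> \<zeta>) (ext_field H)"
    proof (rule orthogonal_imp_invariant_inner)
      \<comment> \<open>The identity \<open>g\<close> holds at every point, in particular at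
        \<open>(x, p)\<close> and at \<open>(q, y)\<close>; at each of them the \<open>D2\<close>
        term cancels the \<open>D1\<close> term.\<close>
      show "?a \<bullet> ext_field H \<zeta> = 0" for \<zeta>
        by (simp add: ext_field_def case_prod_beta g)
    qed
  next
    assume inv: "invariant (\<lambda>\<zeta>. ?a \<bullet> \<zeta>) (ext_field H)"
    \<comment> \<open>The factor 1/2 in \<open>?a\<close> compensates for each component occurring
      twice.\<close>
    have double: "?a \<bullet> ((fst z, fst z), (snd z, snd z)) = (aq, ap) \<bullet> z" for z
      by (cases z) simp
    show "invariant (\<lambda>z. (aq, ap) \<bullet> z) (ham_field H)"
      unfolding invariant_def
    proof (intro allI impI ballI)
      fix I z s t assume sol: "is_solution (ham_field H) I z" and st: "s \<in> I" "t \<in> I"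
      have "?a \<bullet> ((fst (z s), fst (z s)), (snd (z s), snd (z s))) = ?a \<bullet> ((fst (z t), fst (z t)), (snd (z t), snd (z t)))"
        using inv[unfolded invariant_def, rule_format, OF is_solution_ext_field_double[OF sol] st] .
      then show "(aq, ap) \<bullet> z s = (aq, ap) \<bullet> z t"
        unfolding double .
    qed
  qed
  \<comment> \<open>Linearity is automatic for inner products with a fixed vector, so only the
    equivalence of the two invariance statements remains.\<close>
  then show ?thesis
    by (simp only: linear_invariant_def bounded_linear.linear[OF bounded_linear_inner_right] simp_thms)
qed

end
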